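(* Let $0<\beta<2$, $d\in\mathbb{N}$ and $R>0$. Then for every $\mu>0$ there exists $u\in C_c^\infty(\mathbb{R}^d)$ such that \[0<\Gamma_2(u)(x)<\mu\big(\mathcal{L}u(x)\big)^2\quad\text{for all }x\in\mathbb{R}^d\text{ with }|x|\le R.\] In particular, the curvature-dimension inequality $\Gamma_2(u)\ge\frac1N(\mathcal{L}u)^2$ (i.e. $CD(0,N)$) fails on all of $\overline{B_R(0)}$ for every finite $N>0$.
   Context: $c_{\beta,d}=\frac{2^\beta\Gamma(\frac{d+\beta}{2})}{\pi^{d/2}|\Gamma(-\frac{\beta}{2})|}$; $\mathcal{L}u(x)=c_{\beta,d}\int_{\mathbb{R}^d}\frac{u(x+h)-2u(x)+u(x-h)}{|h|^{d+\beta}}dh$; $\Gamma_2(u)(x)=c_{\beta,d}^2\int_{\mathbb{R}^d}\int_{\mathbb{R}^d}\frac{[u(x+h+\sigma)-u(x+h)-u(x+\sigma)+u(x)]^2}{|h|^{d+\beta}|\sigma|^{d+\beta}}dh\,d\sigma$. *)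

theory Defs
  imports "HOL-Analysis.Analysis"
begin

fun C_k :: "nat \<Rightarrow> ('a::euclidean_space \<Rightarrow> real) \<Rightarrow> bool" where
  "C_k 0 f = continuous_on UNIV f"
| "C_k (Suc k) f = ((\<forall>x. f differentiable (at x)) \<and>
      (\<forall>i\<in>Basis. C_k k (\<lambda>x. frechet_derivative f (at x) i)))"

definition smooth :: "('a::euclidean_space \<Rightarrow> real) \<Rightarrow> bool" where
  "smooth f \<longleftrightarrow> (\<forall>k. C_k k f)"

definition compact_support :: "('a::euclidean_space \<Rightarrow> real) \<Rightarrow> bool" where
  "compact_support f \<longleftrightarrow> compact (closure {x. f x \<noteq> 0})"

definition c_const :: "real \<Rightarrow> nat \<Rightarrow> real" where
  "c_const \<beta> d = 2 powr \<beta> * Gamma ((real d + \<beta>) / 2) /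
      (pi powr (real d / 2) * \<bar>Gamma (- \<beta> / 2)\<bar>)"

definition fracL :: "real \<Rightarrow> (real^'n \<Rightarrow> real) \<Rightarrow> real^'n \<Rightarrow> real" where
  "fracL \<beta> u x = c_const \<beta> CARD('n) *
     (LINT h|lborel. (u (x + h) - 2 * u x + u (x - h)) / norm h powr (real CARD('n) + \<beta>))"

definition Gamma2 :: "real \<Rightarrow> (real^'n \<Rightarrow> real) \<Rightarrow> real^'n \<Rightarrow> real" where
  "Gamma2 \<beta> u x = (c_const \<beta> CARD('n))\<^sup>2 *
     (LINT h|lborel. LINT \<sigma>|lborel.
        (u (x + h + \<sigma>) - u (x + h) - u (x + \<sigma>) + u x)\<^sup>2 /
        (norm h powr (real CARD('n) + \<beta>) * norm \<sigma> powr (real CARD('n) + \<beta>)))"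

end

theory Submission
  imports Defs
begin

text \<open>
  The dilates \<open>v\<^sub>r(x) = r powr \<beta> * \<phi>(x / r)\<close> of a cutoff \<open>\<phi>\<close> have \<open>fracL\<close> and \<open>Gamma2\<close> of size
  independent of \<open>r\<close>. On the ball of radius \<open>R\<close>, where all dilates with \<open>r \<ge> R\<close> attain their maximum, their
  fractional Laplacians share the same sign and add up, so the sum over \<open>r = R * 2 ^ k\<close>, \<open>k < K\<close>, has
  \<open>(fracL)\<^sup>2\<close> of order \<open>K\<^sup>2\<close>. The quadratic form \<open>Gamma2\<close>, however, is almost orthogonal on
  different scales: \<open>\<phi>\<close> has mixed differences at most \<open>C * min 1 |h| * min 1 |\<sigma>|\<close>, and with this bound
  the cross term of scales \<open>j\<close> and \<open>k\<close> decays geometrically in \<open>|j - k|\<close>. Hence \<open>Gamma2\<close> is only of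
  order \<open>K\<close>, and the quotient tends to 0.
\<close>

subsection \<open>Smooth functions and a cutoff\<close>

text \<open>Derivatives are unique, so an explicit derivative may stand in for the
  \<open>frechet_derivative\<close> in \<open>C_k\<close>; the usual calculus rules then apply
  directly.\<close>

lemma C_k_SucI:
  assumes "\<And>x. (f has_derivative f' x) (at x)"
    and "\<And>i. i \<in> Basis \<Longrightarrow> C_k k (\<lambda>x. f' x i)"
  shows "C_k (Suc k) f"
proof -
  have "frechet_derivative f (at x) = f' x" for x
    using frechet_derivative_at[OF assms(1)] by simp
  then show ?thesis
    using assms by (auto simp: differentiable_def)
qed

lemma C_k_Suc_has_derivative:
  assumes "C_k (Suc k) f"
  shows "(f has_derivative frechet_derivative f (at x)) (at x)"
  using assms by (simp add: frechet_derivative_works[symmetric])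

lemma C_k_Suc_imp_C_k: "C_k (Suc k) f \<Longrightarrow> C_k k f"
proof (induction k arbitrary: f)
  case 0
  then show ?case
    by (auto intro!: continuous_at_imp_continuous_on differentiable_imp_continuous_within)
next
  case (Suc k)
  then have "C_k k (\<lambda>x. frechet_derivative f (at x) i)" if "i \<in> Basis" for i
    using that C_k.simps(2)[of "Suc k" f] by blast
  moreover have "f differentiable (at x)" for x
    using Suc.prems C_k.simps(2)[of "Suc k" f] by blast
  ultimately show ?case by simp
qed

lemma C_k_const: "C_k k (\<lambda>_. c)"
proof (induction k arbitrary: c)
  case (Suc k)
  show ?case
    by (rule C_k_SucI[where f' = "\<lambda>_ _. 0"]) (auto intro: Suc.IH)
qed auto

lemma C_k_add:
  assumes "C_k k f" "C_k k g"
  shows "C_k k (\<lambda>x. f x + g x)"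
  using assms
proof (induction k arbitrary: f g)
  case 0
  then show ?case by (auto intro: continuous_on_add)
next
  case (Suc k)
  have "C_k k (\<lambda>x. frechet_derivative f (at x) i)" "C_k k (\<lambda>x. frechet_derivative g (at x) i)"
    if "i \<in> Basis" for i
    using Suc.prems that by auto
  then show ?case
    by (intro C_k_SucI[OF has_derivative_add[OF Suc.prems[THEN C_k_Suc_has_derivative]]] Suc.IH)
qed

lemma C_k_mult:
  assumes "C_k k f" "C_k k g"
  shows "C_k k (\<lambda>x. f x * g x)"
  using assms
proof (induction k arbitrary: f g)
  case 0
  then show ?case by (auto intro: continuous_on_mult)
next
  case (Suc k)
  \<comment> \<open>The product rule leaves undifferentiated factors beside the derivatives, so
    \<open>f\<close> and \<open>g\<close> themselves are also needed at order
    \<open>k\<close>.\<close>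
  have "C_k k f" "C_k k g"
    using Suc.prems C_k_Suc_imp_C_k by blast+
  moreover have "C_k k (\<lambda>x. frechet_derivative f (at x) i)" "C_k k (\<lambda>x. frechet_derivative g (at x) i)"
    if "i \<in> Basis" for i
    using Suc.prems that by auto
  ultimately show ?case
    by (intro C_k_SucI[OF has_derivative_mult[OF Suc.prems[THEN C_k_Suc_has_derivative]]]
        C_k_add Suc.IH)
qed

text \<open>The chain rule turns \<open>D n (g x)\<close> into \<open>D (Suc n) (g x)\<close> times
  a derivative of \<open>g\<close>. Induction on \<open>k\<close> for all \<open>n\<close> at once
  therefore closes without a formula for higher derivatives of a composition.\<close>

lemma C_k_compose_real:
  fixes g :: "'a::euclidean_space \<Rightarrow> real"
  assumes D: "\<And>n t. (D n has_real_derivative D (Suc n) t) (at t)"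
    and g: "\<And>k. C_k k g"
  shows "C_k k (\<lambda>x. D n (g x))"
proof (induction k arbitrary: n)
  case 0
  have "continuous_on UNIV (D n)"
    using DERIV_isCont[OF D] by (auto intro!: continuous_at_imp_continuous_on)
  moreover have "continuous_on UNIV g"
    using g[of 0] by simp
  ultimately show ?case
    by (auto intro: continuous_on_compose2)
next
  case (Suc k)
  have "((\<lambda>x. D n (g x)) has_derivative
      (\<lambda>h. D (Suc n) (g x) * frechet_derivative g (at x) h)) (at x)" for x
    using has_derivative_compose[OF C_k_Suc_has_derivative[OF g]
        D[of n "g x", unfolded has_field_derivative_def]] by simp
  then show ?case
    by (rule C_k_SucI) (use Suc.IH g[of "Suc k"] in \<open>auto intro!: C_k_mult\<close>)
qed

lemma C_k_inner_left: "C_k k (\<lambda>x. x \<bullet> a)"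
proof (cases k)
  case (Suc l)
  have "((\<lambda>x. x \<bullet> a) has_derivative (\<lambda>h. h \<bullet> a)) (at x)" for x
    by (auto intro!: derivative_eq_intros)
  then show ?thesis
    unfolding Suc by (rule C_k_SucI) (rule C_k_const)
qed (auto intro: continuous_intros)

lemma C_k_norm_squared: "C_k k (\<lambda>x. (norm x)\<^sup>2)"
proof (cases k)
  case 0
  then show ?thesis by (auto intro: continuous_intros)
next
  case (Suc l)
  have "((\<lambda>x. x \<bullet> x) has_derivative (\<lambda>h. 2 * (x \<bullet> h))) (at x)" for x :: 'a
    by (auto intro!: derivative_eq_intros simp: inner_commute)
  then show ?thesis
    unfolding Suc power2_norm_eq_inner
    by (rule C_k_SucI) (auto intro!: C_k_mult C_k_const C_k_inner_left)
qed

text \<open>The polynomial factor in \<open>1 / t\<close> makes this family closed under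
  differentiation; \<open>p = 1\<close> gives the classical flat function exp(-1/t).\<close>

definition exp_cutoff :: "real poly \<Rightarrow> real \<Rightarrow> real" where
  "exp_cutoff p t = (if t > 0 then poly p (1 / t) * exp (- 1 / t) else 0)"

abbreviation flat_exp :: "real \<Rightarrow> real" where
  "flat_exp \<equiv> exp_cutoff 1"

lemma tendsto_poly_times_exp_minus: "((\<lambda>s. poly p s * exp (- s)) \<longlongrightarrow> (0::real)) at_top"
proof -
  have "((\<lambda>s. \<Sum>i\<le>degree p. coeff p i * (s ^ i / exp s)) \<longlongrightarrow> (\<Sum>i\<le>degree p. coeff p i * 0)) at_top"
    by (intro tendsto_intros tendsto_power_div_exp_0)
  then show ?thesis
    by (simp add: poly_altdef sum_distrib_right exp_minus divide_inverse mult.assoc)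
qed

lemma exp_cutoff_tendsto_at_0: "(exp_cutoff p \<longlongrightarrow> 0) (at 0)"
proof (rule filterlim_split_at)
  show "(exp_cutoff p \<longlongrightarrow> 0) (at_left 0)"
    by (rule tendsto_eventually) (auto simp: exp_cutoff_def eventually_at_filter)
  have "((\<lambda>t. poly p (inverse t) * exp (- inverse t)) \<longlongrightarrow> 0) (at_right 0)"
    by (rule filterlim_compose[OF tendsto_poly_times_exp_minus filterlim_inverse_at_top_right])
  then show "(exp_cutoff p \<longlongrightarrow> 0) (at_right 0)"
    by (rule Lim_transform_eventually)
      (auto simp: exp_cutoff_def eventually_at_filter divide_inverse)
qed

text \<open>With s = 1/t, differentiating p(s) exp(-s) in t gives s^2 (p(s) - p'(s)) exp(-s), again
  a polynomial in s times exp(-s).\<close>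

lemma exp_cutoff_has_derivative:
  "(exp_cutoff p has_real_derivative exp_cutoff (monom 1 2 * (p - pderiv p)) t) (at t)"
proof -
  consider "t > 0" | "t < 0" | "t = 0" by linarith
  then show ?thesis
  proof cases
    case 1
    have "((\<lambda>t. poly p (1 / t) * exp (- 1 / t)) has_real_derivative
        exp_cutoff (monom 1 2 * (p - pderiv p)) t) (at t)"
      using 1 by (auto intro!: derivative_eq_intros DERIV_chain2[OF poly_DERIV]
          simp: exp_cutoff_def poly_monom field_simps power2_eq_square)
    then show ?thesis
      by (rule has_field_derivative_transform_within_open[of _ _ _ "{0<..}"])
        (use 1 in \<open>auto simp: exp_cutoff_def\<close>)
  next
    case 2
    have "((\<lambda>_. 0) has_real_derivative exp_cutoff (monom 1 2 * (p - pderiv p)) t) (at t)"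
      using 2 by (simp add: exp_cutoff_def)
    then show ?thesis
      by (rule has_field_derivative_transform_within_open[of _ _ _ "{..<0}"])
        (use 2 in \<open>auto simp: exp_cutoff_def\<close>)
  next
    case 3
    \<comment> \<open>Dividing by \<open>h\<close> multiplies the polynomial by its variable, so the
      difference quotient at 0 is again a member of the family and tends to 0.\<close>
    have "((\<lambda>h. exp_cutoff p h / h) \<longlongrightarrow> 0) (at 0)"
      by (rule Lim_transform_eventually[OF exp_cutoff_tendsto_at_0[of "monom 1 1 * p"]])
        (auto simp: exp_cutoff_def eventually_at_filter poly_monom)
    then show ?thesis
      using 3 by (simp add: DERIV_def exp_cutoff_def)
  qed
qed

lemma smooth_exp_cutoff_compose:
  assumes "smooth g"
  shows "smooth (\<lambda>x. exp_cutoff p (g x))"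
proof -
  \<comment> \<open>\<open>D n\<close> is the n-th derivative: the polynomial operator of
    \<open>exp_cutoff_has_derivative\<close> is iterated n times.\<close>
  define D where "D n = exp_cutoff (((\<lambda>p. monom 1 2 * (p - pderiv p)) ^^ n) p)" for n
  have "(D n has_real_derivative D (Suc n) t) (at t)" for n t
    unfolding D_def funpow.simps o_apply by (rule exp_cutoff_has_derivative)
  then have "C_k k (\<lambda>x. D 0 (g x))" for k
    by (rule C_k_compose_real[of D g k 0]) (use assms in \<open>auto simp: smooth_def\<close>)
  then show ?thesis
    by (simp add: smooth_def D_def)
qed

lemma flat_exp_nonneg: "0 \<le> flat_exp t"
  by (simp add: exp_cutoff_def)

lemma flat_exp_mono: "s \<le> t \<Longrightarrow> flat_exp s \<le> flat_exp t"
  by (auto simp: exp_cutoff_def frac_le)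

text \<open>Constant near the origin because the inner term vanishes for \<open>norm x \<le> 1\<close>, and zero for
  \<open>norm x \<ge> 2\<close> because \<open>4 * exp (- 1) \<ge> 1\<close>; nesting avoids the usual quotient.\<close>

definition bump :: "'a::euclidean_space \<Rightarrow> real" where
  "bump x = flat_exp (1 - 4 * flat_exp ((norm x)\<^sup>2 - 1))"

lemma smooth_add: "smooth f \<Longrightarrow> smooth g \<Longrightarrow> smooth (\<lambda>x. f x + g x)"
  by (simp add: smooth_def C_k_add)

lemma smooth_mult: "smooth f \<Longrightarrow> smooth g \<Longrightarrow> smooth (\<lambda>x. f x * g x)"
  by (simp add: smooth_def C_k_mult)

lemma smooth_const: "smooth (\<lambda>_. c)"
  by (simp add: smooth_def C_k_const)

lemma smooth_sum:
  "finite I \<Longrightarrow> (\<And>i. i \<in> I \<Longrightarrow> smooth (f i)) \<Longrightarrow> smooth (\<lambda>x. \<Sum>i\<in>I. f i x)"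
  by (induction rule: finite_induct) (auto intro: smooth_const smooth_add)

lemma smooth_imp_continuous_on: "smooth f \<Longrightarrow> continuous_on UNIV f"
  unfolding smooth_def using C_k.simps(1) by blast

text \<open>\<open>bump\<close> depends on \<open>x\<close> through the squared norm only, so the
  dilation becomes a constant factor in front of it and no chain rule for maps between vector spaces
  is involved.\<close>

lemma smooth_bump_scaled: "smooth (\<lambda>x. bump (x /\<^sub>R r))"
proof -
  have 1: "smooth (\<lambda>x::'a. (inverse r)\<^sup>2 * (norm x)\<^sup>2 + - 1)"
    by (intro smooth_add smooth_mult smooth_const) (simp add: smooth_def C_k_norm_squared)
  have "smooth (\<lambda>x::'a. flat_exp (1 + - 4 * flat_exp ((inverse r)\<^sup>2 * (norm x)\<^sup>2 + - 1)))"
    by (rule smooth_exp_cutoff_compose)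
      (intro smooth_add smooth_mult smooth_const smooth_exp_cutoff_compose 1)
  then show ?thesis
    by (simp add: bump_def power_mult_distrib power_inverse)
qed

lemma bump_nonneg: "0 \<le> bump x"
  by (simp add: bump_def flat_exp_nonneg)

lemma bump_le: "bump x \<le> exp (- 1)"
proof -
  have "bump x \<le> flat_exp 1"
    unfolding bump_def by (rule flat_exp_mono) (simp add: flat_exp_nonneg)
  then show ?thesis by (simp add: exp_cutoff_def)
qed

lemma bump_eq:
  assumes "norm x \<le> 1"
  shows "bump x = exp (- 1)"
proof -
  have "(norm x)\<^sup>2 \<le> 1"
    using assms by (simp add: power_le_one)
  then show ?thesis
    by (simp add: bump_def exp_cutoff_def)
qed

lemma bump_eq_0:
  assumes "2 \<le> norm x"
  shows "bump x = 0"
proof -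
  have "2\<^sup>2 \<le> (norm x)\<^sup>2"
    using assms by (intro power_mono) auto
  then have "flat_exp 1 \<le> flat_exp ((norm x)\<^sup>2 - 1)"
    by (intro flat_exp_mono) auto
  moreover have "flat_exp 1 \<ge> 1 / 4"
    using exp_le by (simp add: exp_cutoff_def exp_minus field_simps)
  ultimately show ?thesis
    by (simp add: bump_def exp_cutoff_def[of _ "1 - _"])
qed

subsection \<open>Mixed second differences\<close>

lemma compact_supportI:
  assumes "\<And>x. B \<le> norm x \<Longrightarrow> f x = 0"
  shows "compact_support f"
proof -
  have "{x. f x \<noteq> 0} \<subseteq> cball 0 B"
    using assms by force
  then show ?thesis
    unfolding compact_support_def
    using bounded_cball bounded_subset compact_closure by blast
qed

lemma compact_support_imp_bounded:
  assumes "continuous_on UNIV f" "compact_support f"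
  shows "\<exists>B. \<forall>x. \<bar>f x\<bar> \<le> B"
proof -
  have "compact (f ` closure {x. f x \<noteq> 0})"
    using assms unfolding compact_support_def
    by (intro compact_continuous_image) (auto intro: continuous_on_subset)
  then obtain B where "\<forall>y\<in>f ` closure {x. f x \<noteq> 0}. norm y \<le> B"
    using compact_imp_bounded bounded_iff by metis
  then have "\<bar>f x\<bar> \<le> max B 0" for x
    using closure_subset[of "{x. f x \<noteq> 0}"] by (cases "f x = 0") force+
  then show ?thesis by blast
qed

lemma compact_support_frechet_derivative:
  assumes "compact_support f"
  shows "compact_support (\<lambda>x. frechet_derivative f (at x) i)"
proof -
  let ?S = "closure {x. f x \<noteq> 0}"
  have "frechet_derivative f (at x) i = 0" if "x \<notin> ?S" for x
  proof -
    have "(f has_derivative (\<lambda>_. 0)) (at x)"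
      by (rule has_derivative_transform_within_open[where f = "\<lambda>_. 0" and s = "- ?S"])
        (use that closure_subset[of "{x. f x \<noteq> 0}"] in auto)
    then show ?thesis
      using frechet_derivative_at by metis
  qed
  then have "closure {x. frechet_derivative f (at x) i \<noteq> 0} \<subseteq> ?S"
    by (intro closure_minimal) auto
  then show ?thesis
    using assms unfolding compact_support_def
    by (metis closed_closure compact_Int_closed inf.absorb_iff2)
qed

text \<open>A single modulus for two bounds on differences: Lipschitz continuity for small
  \<open>h\<close> and boundedness for large \<open>h\<close>.\<close>

definition mnorm :: "'a::real_normed_vector \<Rightarrow> real" where
  "mnorm h = min 1 (norm h)"

lemma mnorm_nonneg: "0 \<le> mnorm h"
  by (simp add: mnorm_def)

text \<open>The mean value inequality gives a bound linear in \<open>norm h\<close>, with the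
  operator norm of \<open>g' x\<close> at most \<open>DIM('a) * B\<close>; the triangle inequality
  gives \<open>2 * B\<close>. The stated constant dominates both.\<close>

lemma difference_le_mnorm:
  fixes g :: "'a::euclidean_space \<Rightarrow> real"
  assumes diff: "\<And>x. (g has_derivative g' x) (at x)"
    and g: "\<And>x. \<bar>g x\<bar> \<le> B"
    and g': "\<And>x i. i \<in> Basis \<Longrightarrow> \<bar>g' x i\<bar> \<le> B"
  shows "\<bar>g (x + h) - g x\<bar> \<le> (2 + real DIM('a)) * B * mnorm h"
proof -
  have B: "0 \<le> B"
    using g[of 0] by linarith
  have "onorm (g' x) \<le> (\<Sum>i\<in>Basis. norm (g' x i))" for x
    by (rule onorm_componentwise[OF has_derivative_bounded_linear[OF diff]])
  also have "(\<Sum>i\<in>Basis. norm (g' x i)) \<le> real DIM('a) * B" for x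
    by (rule sum_bounded_above[THEN order_trans]) (use g' in auto)
  finally have "norm (g (x + h) - g x) \<le> real DIM('a) * B * norm ((x + h) - x)"
    by (intro differentiable_bound[of UNIV g g']) (use diff in auto)
  moreover have "\<bar>g (x + h) - g x\<bar> \<le> 2 * B"
    using g[of "x + h"] g[of x] by linarith
  moreover have "2 * B \<le> (2 + real DIM('a)) * B"
    "real DIM('a) * B * norm h \<le> (2 + real DIM('a)) * B * norm h"
    using B by (auto intro!: mult_right_mono simp: algebra_simps)
  ultimately show ?thesis
    by (auto simp: mnorm_def min_def)
qed

text \<open>\<open>difference_le_mnorm\<close> is applied twice. In direction \<open>k\<close> it
  bounds the increments of \<open>u\<close> and of its partial derivatives by a multiple of
  \<open>mnorm k\<close>; in direction \<open>h\<close> it is then applied to the increment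
  \<open>u (x + k) - u x\<close> as a function of \<open>x\<close>.\<close>

lemma mixed_difference_le_mnorm:
  fixes u :: "'a::euclidean_space \<Rightarrow> real"
  assumes u: "smooth u" "compact_support u"
  shows "\<exists>C\<ge>0. \<forall>x h k. \<bar>u (x + h + k) - u (x + h) - u (x + k) + u x\<bar> \<le> C * mnorm h * mnorm k"
proof -
  let ?d = "\<lambda>x. frechet_derivative u (at x)"
  have u2: "C_k (Suc (Suc 0)) u"
    using u(1) unfolding smooth_def by blast
  have du1: "C_k (Suc 0) (\<lambda>x. ?d x i)" if "i \<in> Basis" for i
    using u2 that C_k.simps(2) by blast
  have u': "(u has_derivative ?d x) (at x)" for x
    by (rule C_k_Suc_has_derivative[OF u2])
  have u'': "((\<lambda>x. ?d x i) has_derivative frechet_derivative (\<lambda>x. ?d x i) (at x)) (at x)"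
    if "i \<in> Basis" for x i
    by (rule C_k_Suc_has_derivative[OF du1[OF that]])
  have "\<exists>B0. \<forall>x. \<bar>u x\<bar> \<le> B0"
    by (intro compact_support_imp_bounded smooth_imp_continuous_on u)
  then obtain B0 where B0: "\<And>x. \<bar>u x\<bar> \<le> B0" by blast
  have "\<exists>B1. \<forall>x. \<bar>?d x i\<bar> \<le> B1" if "i \<in> Basis" for i
    using C_k_Suc_imp_C_k[OF du1[OF that]]
    by (intro compact_support_imp_bounded compact_support_frechet_derivative u) auto
  then obtain B1 where B1: "\<And>x i. i \<in> Basis \<Longrightarrow> \<bar>?d x i\<bar> \<le> B1 i" by metis
  have "\<exists>B2. \<forall>x. \<bar>frechet_derivative (\<lambda>x. ?d x i) (at x) j\<bar> \<le> B2"
    if "i \<in> Basis" "j \<in> Basis" for i j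
    using du1[OF that(1)] that(2)
    by (intro compact_support_imp_bounded compact_support_frechet_derivative u) auto
  then obtain B2 where B2: "\<And>x i j. i \<in> Basis \<Longrightarrow> j \<in> Basis \<Longrightarrow>
      \<bar>frechet_derivative (\<lambda>x. ?d x i) (at x) j\<bar> \<le> B2 i j" by metis
  \<comment> \<open>One common bound for \<open>u\<close> and its partial derivatives of order one
    and two: the sum of nonnegative bounds dominates each of them.\<close>
  define B where "B = B0 + (\<Sum>i\<in>Basis. B1 i) + (\<Sum>i\<in>Basis. \<Sum>j\<in>Basis. B2 i j)"
  have B0': "0 \<le> B0"
    using B0[of 0] by linarith
  have B1': "0 \<le> B1 i" if "i \<in> Basis" for i
    using B1[OF that, of 0] by linarith
  have B2': "0 \<le> B2 i j" if "i \<in> Basis" "j \<in> Basis" for i j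
    using B2[OF that, of 0] by linarith
  have 1: "0 \<le> (\<Sum>i\<in>Basis. B1 i)" "0 \<le> (\<Sum>i\<in>Basis. \<Sum>j\<in>Basis. B2 i j)"
    by (auto intro!: sum_nonneg B1' B2')
  have b0: "\<bar>u x\<bar> \<le> B" for x
    using B0[of x] 1 by (simp add: B_def)
  have b1: "\<bar>?d x i\<bar> \<le> B" if "i \<in> Basis" for x i
    using B1[OF that, of x] member_le_sum[of i Basis B1] that B1' 1 B0' by (simp add: B_def)
  have b2: "\<bar>frechet_derivative (\<lambda>x. ?d x i) (at x) j\<bar> \<le> B" if "i \<in> Basis" "j \<in> Basis" for x i j
    using B2[OF that, of x] member_le_sum[of j Basis "B2 i"]
      member_le_sum[of i Basis "\<lambda>i. \<Sum>j\<in>Basis. B2 i j"] that B2' 1 B0'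
    by (simp add: B_def sum_nonneg)
  define M where "M = 2 + real DIM('a)"
  have w: "\<bar>u (x + k) - u x\<bar> \<le> M * B * mnorm k" for x k
    unfolding M_def by (rule difference_le_mnorm[OF u' b0 b1])
  have w': "\<bar>?d (x + k) i - ?d x i\<bar> \<le> M * B * mnorm k" if "i \<in> Basis" for x k i
    unfolding M_def by (rule difference_le_mnorm[OF u''[OF that] b1[OF that] b2[OF that]])
  have shift: "((\<lambda>x. u (x + k)) has_derivative ?d (x + k)) (at x)" for x k
    by (rule has_derivative_compose[OF _ u', of "\<lambda>x. x + k" "\<lambda>h. h" x UNIV])
      (auto intro!: derivative_eq_intros)
  have *: "\<bar>(u (x + h + k) - u (x + h)) - (u (x + k) - u x)\<bar> \<le> M * (M * B * mnorm k) * mnorm h" for x h k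
    unfolding M_def[symmetric]
    using difference_le_mnorm[OF has_derivative_diff[OF shift u'] w w', of x h k]
    by (simp add: M_def)
  have "\<bar>u (x + h + k) - u (x + h) - u (x + k) + u x\<bar> \<le> (M * M * B) * mnorm h * mnorm k" for x h k
    using *[of x h k] by (simp add: algebra_simps)
  moreover have "0 \<le> M * M * B"
    using b0[of 0] by (simp add: M_def)
  ultimately show ?thesis by blast
qed

subsection \<open>Integrals against the kernel\<close>

text \<open>\<open>f\<close> is dominated by the sum of the \<open>c k\<close> times indicators of
  the balls of radius \<open>r k\<close>, whose integral is a multiple of the given series. With
  dyadic radii this takes the place of polar coordinates.\<close>

lemma integrable_of_ball_cover:
  fixes f :: "'a::euclidean_space \<Rightarrow> real" and c r :: "nat \<Rightarrow> real"
  assumes [measurable]: "f \<in> borel_measurable borel"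
    and nonneg: "\<And>h. 0 \<le> f h" "\<And>k. 0 \<le> c k" "\<And>k. 0 \<le> r k"
    and cover: "\<And>h. f h \<noteq> 0 \<Longrightarrow> \<exists>k. norm h \<le> r k \<and> f h \<le> c k"
    and sum: "summable (\<lambda>k. c k * r k ^ DIM('a))"
  shows "integrable lborel f"
proof -
  have le: "ennreal (f h) \<le> (\<Sum>k. ennreal (c k) * indicator (cball 0 (r k)) h)" for h
  proof (cases "f h = 0")
    case False
    then obtain k where "norm h \<le> r k" "f h \<le> c k"
      using cover by blast
    define F where "F k = ennreal (c k) * indicator (cball 0 (r k)) h" for k
    have "ennreal (f h) \<le> F k"
      using \<open>norm h \<le> r k\<close> \<open>f h \<le> c k\<close> by (simp add: F_def ennreal_leI)
    also have "F k \<le> (\<Sum>k. F k)"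
      using sum_le_suminf[of F "{k}", OF summableI] by simp
    finally show ?thesis
      unfolding F_def .
  qed simp
  have [measurable]: "cball (0::'a) (r k) \<in> sets borel" for k
    by simp
  have "(\<integral>\<^sup>+h. ennreal (f h) \<partial>lborel)
      \<le> (\<integral>\<^sup>+h. (\<Sum>k. ennreal (c k) * indicator (cball 0 (r k)) h) \<partial>(lborel :: 'a measure))"
    by (rule nn_integral_mono) (rule le)
  also have "\<dots> = (\<Sum>k. ennreal (c k) * emeasure lborel (cball (0::'a) (r k)))"
    by (subst nn_integral_suminf, measurable) (simp add: nn_integral_cmult_indicator)
  also have "\<dots> = (\<Sum>k. ennreal (unit_ball_vol (DIM('a)) * (c k * r k ^ DIM('a))))"
    using nonneg by (simp add: emeasure_cball ennreal_mult[symmetric] mult_ac)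
  also have "\<dots> < top"
    using nonneg sum by (subst less_top[symmetric]) (intro ennreal_suminf_neq_top summable_mult; simp)
  finally show ?thesis
    using nonneg by (simp add: integrable_iff_bounded)
qed

lemma ex_dyadic_interval:
  fixes x :: real
  assumes "1 \<le> x"
  shows "\<exists>k. 2 ^ k \<le> x \<and> x \<le> 2 ^ Suc k"
proof -
  define k where "k = nat \<lfloor>log 2 x\<rfloor>"
  have "0 \<le> log 2 x"
    using assms by simp
  then have "real k \<le> log 2 x" "log 2 x \<le> real (Suc k)"
    unfolding k_def by linarith+
  then have "2 powr real k \<le> x" "x \<le> 2 powr real (Suc k)"
    using assms by (simp_all add: le_log_iff log_le_iff del: of_nat_Suc)
  then show ?thesis
    by (auto simp: powr_realpow simp del: of_nat_Suc)
qed

text \<open>At \<open>h = 0\<close> the value is 0, by the conventions for \<open>powr\<close> and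
  division. The case \<beta> = 0 serves to write powers of \<open>norm h\<close> relative to the
  critical power -d.\<close>

definition levy_kernel :: "real \<Rightarrow> 'a::euclidean_space \<Rightarrow> real" where
  "levy_kernel \<beta> h = 1 / norm h powr (real DIM('a) + \<beta>)"

lemma kernel_nonneg: "0 \<le> levy_kernel \<beta> h"
  by (simp add: levy_kernel_def)

lemma kernel_measurable [measurable]: "levy_kernel \<beta> \<in> borel_measurable borel"
  unfolding levy_kernel_def by measurable

lemma mnorm_measurable [measurable]: "mnorm \<in> borel_measurable borel"
  unfolding mnorm_def by measurable

lemma kernel_scaled:
  fixes h :: "'a::euclidean_space"
  assumes "0 < r"
  shows "levy_kernel \<beta> (h /\<^sub>R r) = r powr (real DIM('a) + \<beta>) * levy_kernel \<beta> h"
  using assms by (simp add: levy_kernel_def powr_mult powr_divide inverse_eq_divide)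

text \<open>On the shell where \<open>norm h\<close> lies between 2^k and 2^(k+1) the kernel is at
  most 2^(-k(d+t)). Against a ball volume of order 2^(kd) this leaves a geometric series of ratio
  2^(-t).\<close>

lemma integrable_kernel_tail:
  assumes "0 < t"
  shows "integrable lborel (\<lambda>h::'a::euclidean_space. levy_kernel t h * indicator {h. 1 \<le> norm h} h)"
proof (rule integrable_of_ball_cover[where c = "\<lambda>k. (1 / 2 powr (real DIM('a) + t)) ^ k" and r = "\<lambda>k. 2 ^ Suc k"])
  fix h :: 'a
  assume "levy_kernel t h * indicator {h. 1 \<le> norm h} h \<noteq> 0"
  then have h: "1 \<le> norm h"
    by (auto simp: indicator_def split: if_splits)
  then obtain k where k: "2 ^ k \<le> norm h" "norm h \<le> 2 ^ Suc k"
    using ex_dyadic_interval by blast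
  have "(2 powr (real DIM('a) + t)) ^ k = (2 ^ k) powr (real DIM('a) + t)"
    by (simp add: powr_realpow[symmetric] powr_powr mult.commute)
  also have "\<dots> \<le> norm h powr (real DIM('a) + t)"
    using k assms by (intro powr_mono2) auto
  finally have "levy_kernel t h \<le> (1 / 2 powr (real DIM('a) + t)) ^ k"
    by (simp add: levy_kernel_def power_divide frac_le)
  then show "\<exists>k. norm h \<le> 2 ^ Suc k \<and>
      levy_kernel t h * indicator {h. 1 \<le> norm h} h \<le> (1 / 2 powr (real DIM('a) + t)) ^ k"
    using k h by (intro exI[of _ k]) auto
next
  have "(1 / 2 powr (real DIM('a) + t)) ^ k * (2 ^ Suc k) ^ DIM('a) = 2 ^ DIM('a) * (1 / 2 powr t) ^ k" for k
    by (simp add: powr_add powr_realpow power_mult_distrib power_divide power_mult[symmetric] mult.commute)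
  moreover have "summable (\<lambda>k. 2 ^ DIM('a) * (1 / 2 powr t) ^ k)"
    using assms by (intro summable_mult summable_geometric) simp
  ultimately show "summable (\<lambda>k. (1 / 2 powr (real DIM('a) + t)) ^ k * (2 ^ Suc k) ^ DIM('a))"
    by (simp only:)
qed (auto simp: kernel_nonneg)

text \<open>The same argument on shells shrinking to the origin: kernel and ball volume balance, and
  the factor \<open>norm h powr s\<close> supplies the ratio 2^(-s).\<close>

lemma integrable_kernel_origin:
  assumes "0 < s"
  shows "integrable lborel (\<lambda>h::'a::euclidean_space. norm h powr s * levy_kernel 0 h * indicator {h. norm h \<le> 1} h)"
proof (rule integrable_of_ball_cover[where c = "\<lambda>k. (1 / 2 powr s) ^ k * (2 ^ Suc k) ^ DIM('a)" and r = "\<lambda>k. 1 / 2 ^ k"])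
  fix h :: 'a
  assume "norm h powr s * levy_kernel 0 h * indicator {h. norm h \<le> 1} h \<noteq> 0"
  then have h: "0 < norm h" "norm h \<le> 1"
    by (auto simp: indicator_def split: if_splits)
  then have "1 \<le> 1 / norm h"
    by simp
  then obtain k where "2 ^ k \<le> 1 / norm h" "1 / norm h \<le> 2 ^ Suc k"
    using ex_dyadic_interval by blast
  then have k: "norm h \<le> 1 / 2 ^ k" "1 / norm h \<le> 2 ^ Suc k"
    using h by (simp_all add: field_simps)
  have "norm h powr s \<le> (1 / 2 ^ k) powr s"
    using k assms by (intro powr_mono2) auto
  also have "\<dots> = (1 / 2 powr s) ^ k"
    by (simp add: powr_divide power_divide powr_realpow[symmetric] powr_powr mult.commute)
  finally have 1: "norm h powr s \<le> (1 / 2 powr s) ^ k" .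
  have "levy_kernel 0 h = (1 / norm h) ^ DIM('a)"
    using h by (simp add: levy_kernel_def powr_realpow power_divide)
  also have "\<dots> \<le> (2 ^ Suc k) ^ DIM('a)"
    using k by (intro power_mono) auto
  finally have "norm h powr s * levy_kernel 0 h \<le> (1 / 2 powr s) ^ k * (2 ^ Suc k) ^ DIM('a)"
    using 1 by (intro mult_mono) (auto simp: kernel_nonneg)
  then show "\<exists>k. norm h \<le> 1 / 2 ^ k \<and> norm h powr s * levy_kernel 0 h * indicator {h. norm h \<le> 1} h
      \<le> (1 / 2 powr s) ^ k * (2 ^ Suc k) ^ DIM('a)"
    using k h by (intro exI[of _ k]) auto
next
  have "(1 / 2 powr s) ^ k * (2 ^ Suc k) ^ DIM('a) * (1 / 2 ^ k) ^ DIM('a) = 2 ^ DIM('a) * (1 / 2 powr s) ^ k" for k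
    by (simp add: power_mult_distrib power_divide)
  moreover have "summable (\<lambda>k. 2 ^ DIM('a) * (1 / 2 powr s) ^ k)"
    using assms by (intro summable_mult summable_geometric) simp
  ultimately show "summable (\<lambda>k. (1 / 2 powr s) ^ k * (2 ^ Suc k) ^ DIM('a) * (1 / 2 ^ k) ^ DIM('a))"
    by (simp only:)
qed (auto simp: kernel_nonneg)

text \<open>The integrand has exponent \<theta> - \<beta> - d outside the unit ball and 1 + \<theta>
  - \<beta> - d inside. The two hypotheses are exactly integrability at infinity and at the
  origin.\<close>

lemma integrable_mnorm_powr_kernel:
  assumes "\<beta> - 1 < \<theta>" "\<theta> < \<beta>"
  shows "integrable lborel (\<lambda>h::'a::euclidean_space. mnorm h * norm h powr \<theta> * levy_kernel \<beta> h)"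
proof (rule Bochner_Integration.integrable_bound)
  show "integrable lborel (\<lambda>h::'a. levy_kernel (\<beta> - \<theta>) h * indicator {h. 1 \<le> norm h} h
      + norm h powr (1 + \<theta> - \<beta>) * levy_kernel 0 h * indicator {h. norm h \<le> 1} h)"
    using assms by (intro Bochner_Integration.integrable_add integrable_kernel_tail integrable_kernel_origin) auto
  show "AE h::'a in lborel. norm (mnorm h * norm h powr \<theta> * levy_kernel \<beta> h)
      \<le> norm (levy_kernel (\<beta> - \<theta>) h * indicator {h. 1 \<le> norm h} h
      + norm h powr (1 + \<theta> - \<beta>) * levy_kernel 0 h * indicator {h. norm h \<le> 1} h)"
  proof (intro AE_I2)
    fix h :: 'a
    consider "h = 0" | "0 < norm h" "norm h < 1" | "1 \<le> norm h" by fastforce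
    then show "norm (mnorm h * norm h powr \<theta> * levy_kernel \<beta> h)
      \<le> norm (levy_kernel (\<beta> - \<theta>) h * indicator {h. 1 \<le> norm h} h
      + norm h powr (1 + \<theta> - \<beta>) * levy_kernel 0 h * indicator {h. norm h \<le> 1} h)"
    proof cases
      case 2
      then show ?thesis
        by (simp add: mnorm_def levy_kernel_def powr_add powr_diff mult.commute)
    next
      case 3
      have "norm h powr \<theta> * levy_kernel \<beta> h = levy_kernel (\<beta> - \<theta>) h"
        using 3 by (simp add: levy_kernel_def powr_add powr_diff)
      then show ?thesis
        using 3 by (simp add: mnorm_def kernel_nonneg mult.assoc)
    qed simp
  qed
qed measurable

section \<open>Scaling of the kernel integrals\<close>

lemma
  fixes f :: "'a::euclidean_space \<Rightarrow> real"
  assumes r: "0 < r" and f: "integrable lborel f"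
  shows integrable_lborel_scaled: "integrable lborel (\<lambda>h. f (h /\<^sub>R r))"
    and integral_lborel_scaled: "(LINT h|lborel. f (h /\<^sub>R r)) = r ^ DIM('a) * (LINT h|lborel. f h)"
proof -
  have [measurable]: "f \<in> borel_measurable borel"
    using f by auto
  have L: "lborel = density (distr lborel borel (\<lambda>x::'a. x /\<^sub>R r)) (\<lambda>_. inverse r ^ DIM('a))"
    using lborel_affine[of "inverse r" "0::'a"] r by simp
  show "integrable lborel (\<lambda>h. f (h /\<^sub>R r))"
    using f r by (subst (asm) L) (simp add: integrable_density integrable_distr_eq)
  have "(LINT h|lborel. f h) = inverse r ^ DIM('a) * (LINT h|lborel. f (h /\<^sub>R r))"
    using r by (subst L) (simp add: integral_density integral_distr)
  then show "(LINT h|lborel. f (h /\<^sub>R r)) = r ^ DIM('a) * (LINT h|lborel. f h)"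
    using r by (simp add: power_inverse)
qed

lemma
  assumes \<beta>: "0 < \<beta>" and T: "1 \<le> T"
  shows integrable_kernel_outside: "integrable lborel (\<lambda>h::'a::euclidean_space. levy_kernel \<beta> h * indicator {h. T \<le> norm h} h)"
    and integral_kernel_outside_pos: "0 < (LINT h|lborel. levy_kernel \<beta> h * indicator {h::'a. T \<le> norm h} h)"
proof -
  show int: "integrable lborel (\<lambda>h::'a. levy_kernel \<beta> h * indicator {h. T \<le> norm h} h)"
    by (rule Bochner_Integration.integrable_bound[OF integrable_kernel_tail[OF \<beta>]])
      (use T in \<open>auto simp: indicator_def\<close>)
  obtain e :: 'a where e: "e \<in> Basis"
    using nonempty_Basis by blast
  \<comment> \<open>A lower bound for the kernel on the unit ball around
    \<open>(T + 1) *\<^sub>R e\<close>, whose points have norm between \<open>T\<close> and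
    \<open>T + 2\<close>.\<close>
  define c where "c = 1 / (T + 2) powr (real DIM('a) + \<beta>)"
  have "0 < c"
    using T by (simp add: c_def)
  then have "0 < c * measure lborel (ball ((T + 1) *\<^sub>R e) 1)"
    by (simp add: content_ball)
  also have "\<dots> = (LINT h|lborel. c * indicator (ball ((T + 1) *\<^sub>R e) 1) h)"
    by simp
  also have "\<dots> \<le> (LINT h|lborel. levy_kernel \<beta> h * indicator {h::'a. T \<le> norm h} h)"
  proof (rule integral_mono[OF _ int])
    fix h :: 'a
    show "c * indicator (ball ((T + 1) *\<^sub>R e) 1) h \<le> levy_kernel \<beta> h * indicator {h::'a. T \<le> norm h} h"
    proof (cases "h \<in> ball ((T + 1) *\<^sub>R e) 1")
      case True
      then have "norm ((T + 1) *\<^sub>R e - h) < 1"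
        by (simp add: dist_norm)
      moreover have "norm ((T + 1) *\<^sub>R e) = T + 1"
        using e T by simp
      ultimately have h: "T \<le> norm h" "norm h \<le> T + 2"
        using norm_triangle_ineq2[of "(T + 1) *\<^sub>R e" h] norm_triangle_ineq3[of "(T + 1) *\<^sub>R e" h] by auto
      then have "c \<le> levy_kernel \<beta> h"
        unfolding c_def levy_kernel_def using T \<beta> by (intro frac_le powr_mono2) auto
      then show ?thesis
        using True h by simp
    qed (simp add: kernel_nonneg)
  qed (intro integrable_mult_right integrable_real_indicator emeasure_lborel_ball_finite, simp)
  finally show "0 < (LINT h|lborel. levy_kernel \<beta> h * indicator {h::'a. T \<le> norm h} h)" .
qed

text \<open>The kernel mass outside radius \<open>T * r\<close> is proportional to r^(-\<beta>).
  This is why the dilate of scale \<open>r\<close> carries the weight \<open>r powr \<beta>\<close>: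
  each scale then contributes equally to the fractional Laplacian.\<close>

lemma
  assumes \<beta>: "0 < \<beta>" and T: "1 \<le> T" and r: "0 < r"
  shows integrable_kernel_outside_scaled:
      "integrable lborel (\<lambda>h::'a::euclidean_space. levy_kernel \<beta> h * indicator {h. T * r \<le> norm h} h)"
    and integral_kernel_outside_scaled:
      "r powr \<beta> * (LINT h|lborel. levy_kernel \<beta> h * indicator {h::'a. T * r \<le> norm h} h)
        = (LINT h|lborel. levy_kernel \<beta> h * indicator {h::'a. T \<le> norm h} h)"
proof -
  let ?f = "\<lambda>h::'a. levy_kernel \<beta> h * indicator {h. T \<le> norm h} h"
  have eq: "levy_kernel \<beta> h * indicator {h. T * r \<le> norm h} h
      = 1 / r powr (real DIM('a) + \<beta>) * ?f (h /\<^sub>R r)" for h :: 'a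
  proof -
    have "T * r \<le> norm h \<longleftrightarrow> T \<le> norm (h /\<^sub>R r)"
      using r by (simp add: field_simps)
    then show ?thesis
      using r by (simp add: kernel_scaled indicator_def)
  qed
  note int = integrable_kernel_outside[OF \<beta> T, where 'a = 'a]
  show "integrable lborel (\<lambda>h::'a. levy_kernel \<beta> h * indicator {h. T * r \<le> norm h} h)"
    unfolding eq by (intro integrable_mult_right integrable_lborel_scaled r int)
  show "r powr \<beta> * (LINT h|lborel. levy_kernel \<beta> h * indicator {h::'a. T * r \<le> norm h} h) = (LINT h|lborel. ?f h)"
    unfolding eq integral_mult_right_zero integral_lborel_scaled[OF r int]
    using r by (simp add: powr_add powr_realpow)
qed

text \<open>Interpolation between the two branches of the minimum; it extracts the scale
  \<open>b\<close> as a pure factor b^(-\<theta>).\<close>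

lemma mnorm_scaled_le_powr:
  fixes h :: "'a::euclidean_space"
  assumes "0 \<le> \<theta>" "\<theta> \<le> 1" "0 < b"
  shows "mnorm (h /\<^sub>R b) \<le> (norm h / b) powr \<theta>"
proof -
  define t where "t = norm h / b"
  have "min 1 t \<le> t powr \<theta>"
  proof (cases "t < 1")
    case True
    moreover have "0 \<le> t"
      using assms by (simp add: t_def)
    ultimately show ?thesis
      using powr_mono'[of \<theta> 1 t] assms by (simp add: min_def)
  next
    case False
    then show ?thesis
      using assms ge_one_powr_ge_zero[of t \<theta>] by (simp add: min_def)
  qed
  then show ?thesis
    using assms by (simp add: mnorm_def t_def divide_inverse mult.commute)
qed

text \<open>Replacing the factor of scale \<open>b\<close> by (|h|/b)^\<theta> and rescaling by
  \<open>a\<close> bounds the integral by (a/b)^\<theta> a^(-\<beta>) I. Squaring, one factor each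
  for h and \<sigma>, and weighting leaves the exponent 2\<theta> - \<beta>; if it is positive, the
  bound decays as a/b tends to 0.\<close>

lemma
  fixes \<beta> \<theta> a b :: real
  assumes \<theta>: "\<beta> - 1 < \<theta>" "\<theta> < \<beta>" "0 \<le> \<theta>" "\<theta> \<le> 1" and a: "0 < a" and b: "0 < b"
  defines "I \<equiv> (LINT h|lborel. mnorm h * norm h powr \<theta> * levy_kernel \<beta> (h::'a::euclidean_space))"
  shows integrable_mnorm_mnorm_kernel:
      "integrable lborel (\<lambda>h::'a. mnorm (h /\<^sub>R a) * mnorm (h /\<^sub>R b) * levy_kernel \<beta> h)"
    and integral_mnorm_mnorm_kernel:
      "a powr \<beta> * b powr \<beta> * (LINT h|lborel. mnorm (h /\<^sub>R a) * mnorm (h /\<^sub>R b) * levy_kernel \<beta> (h::'a))\<^sup>2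
        \<le> I\<^sup>2 * (a / b) powr (2 * \<theta> - \<beta>)"
proof -
  let ?f = "\<lambda>h::'a. mnorm h * norm h powr \<theta> * levy_kernel \<beta> h"
  let ?g = "\<lambda>h::'a. mnorm (h /\<^sub>R a) * mnorm (h /\<^sub>R b) * levy_kernel \<beta> h"
  let ?c = "(a / b) powr \<theta> / a powr (real DIM('a) + \<beta>)"
  note int = integrable_mnorm_powr_kernel[OF \<theta>(1,2), where 'a = 'a]
  have le: "?g h \<le> ?c * ?f (h /\<^sub>R a)" for h
  proof -
    have "?g h \<le> mnorm (h /\<^sub>R a) * (norm h / b) powr \<theta> * levy_kernel \<beta> h"
      by (intro mult_mono mnorm_scaled_le_powr \<theta> b) (auto simp: mnorm_nonneg kernel_nonneg)
    also have "norm h / b = a / b * norm (h /\<^sub>R a)"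
      using a by (simp add: field_simps)
    also have "\<dots> powr \<theta> = (a / b) powr \<theta> * norm (h /\<^sub>R a) powr \<theta>"
      by (rule powr_mult)
    finally show ?thesis
      using a by (simp add: kernel_scaled mult_ac)
  qed
  have int': "integrable lborel (\<lambda>h. ?c * ?f (h /\<^sub>R a))"
    by (intro integrable_mult_right integrable_lborel_scaled a int)
  show intg: "integrable lborel ?g"
  proof (rule Bochner_Integration.integrable_bound[OF int'])
    show "AE h in lborel. norm (?g h) \<le> norm (?c * ?f (h /\<^sub>R a))"
    proof (intro AE_I2)
      fix h
      show "norm (?g h) \<le> norm (?c * ?f (h /\<^sub>R a))"
        using le[of h] mnorm_nonneg[of "h /\<^sub>R a"] mnorm_nonneg[of "h /\<^sub>R b"] kernel_nonneg[of \<beta> h]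
        by (intro order_trans[OF _ abs_ge_self[of "?c * ?f (h /\<^sub>R a)", folded real_norm_def]]) (simp add: abs_mult)
    qed
  qed measurable
  have "(LINT h|lborel. ?g h) \<le> (LINT h|lborel. ?c * ?f (h /\<^sub>R a))"
    by (rule integral_mono[OF intg int' le])
  also have "\<dots> = (a / b) powr \<theta> / a powr \<beta> * I"
    unfolding integral_mult_right_zero integral_lborel_scaled[OF a int]
    using a by (simp add: I_def powr_add powr_realpow)
  finally have G: "(LINT h|lborel. ?g h) \<le> (a / b) powr \<theta> / a powr \<beta> * I" .
  have "0 \<le> (LINT h|lborel. ?g h)"
    by (intro integral_nonneg_AE AE_I2 mult_nonneg_nonneg mnorm_nonneg kernel_nonneg)
  then have "a powr \<beta> * b powr \<beta> * (LINT h|lborel. ?g h)\<^sup>2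
      \<le> a powr \<beta> * b powr \<beta> * ((a / b) powr \<theta> / a powr \<beta> * I)\<^sup>2"
    using G by (intro mult_left_mono power_mono) auto
  also have "\<dots> = I\<^sup>2 * (a / b) powr (2 * \<theta> - \<beta>)"
  proof -
    have "(a / b) powr (2 * \<theta> - \<beta>) = (a / b) powr \<theta> * (a / b) powr \<theta> / (a / b) powr \<beta>"
      by (simp only: powr_diff mult_2 powr_add)
    moreover have "(a / b) powr \<beta> = a powr \<beta> / b powr \<beta>"
      by (rule powr_divide)
    moreover have "a powr \<beta> \<noteq> 0" "b powr \<beta> \<noteq> 0"
      using a b by auto
    ultimately show ?thesis
      by (simp add: power2_eq_square)
  qed
  finally show "a powr \<beta> * b powr \<beta> * (LINT h|lborel. ?g h)\<^sup>2 \<le> I\<^sup>2 * (a / b) powr (2 * \<theta> - \<beta>)" .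
qed

text \<open>Almost orthogonality: passing from \<open>K\<close> to \<open>Suc K\<close> adds a row,
  a column and a diagonal entry, whose total is bounded independently of \<open>K\<close> by a
  geometric series. Growth is thus linear instead of quadratic.\<close>

lemma double_geometric_sum_le:
  fixes q :: real and a :: "nat \<Rightarrow> nat \<Rightarrow> real"
  assumes q: "0 \<le> q" "q < 1"
    and a: "\<And>j k. j \<le> k \<Longrightarrow> a j k \<le> A * q ^ (k - j)" "\<And>j k. a j k = a k j" and A: "0 \<le> A"
  shows "(\<Sum>j<K. \<Sum>k<K. a j k) \<le> A * (1 + 2 * q / (1 - q)) * real K"
proof (induction K)
  case (Suc K)
  have geo: "(\<Sum>j<K. q ^ (K - j)) \<le> q / (1 - q)" for K
  proof (induction K)
    case (Suc K)
    have "(\<Sum>j<Suc K. q ^ (Suc K - j)) = q * (\<Sum>j<K. q ^ (K - j)) + q"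
      by (simp add: sum_distrib_left Suc_diff_le)
    also have "\<dots> \<le> q * (q / (1 - q)) + q"
      using Suc q by (intro add_right_mono mult_left_mono) auto
    also have "\<dots> = q / (1 - q)"
      using q by (simp add: field_simps)
    finally show ?case .
  qed (use q in simp)
  have "(\<Sum>j<K. a j K) \<le> (\<Sum>j<K. A * q ^ (K - j))"
    by (intro sum_mono a) auto
  also have "\<dots> = A * (\<Sum>j<K. q ^ (K - j))"
    by (simp add: sum_distrib_left)
  also have "\<dots> \<le> A * (q / (1 - q))"
    using geo A by (intro mult_left_mono)
  finally have 1: "(\<Sum>j<K. a j K) \<le> A * (q / (1 - q))" .
  have "(\<Sum>k<K. a K k) = (\<Sum>j<K. a j K)"
    by (rule sum.cong[OF refl a(2)])
  then have "(\<Sum>j<Suc K. \<Sum>k<Suc K. a j k) = (\<Sum>j<K. \<Sum>k<K. a j k) + 2 * (\<Sum>j<K. a j K) + a K K"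
    by (simp add: sum.distrib)
  also have "\<dots> \<le> A * (1 + 2 * q / (1 - q)) * real K + 2 * (A * (q / (1 - q))) + A"
    using Suc 1 a(1)[of K K] by simp
  also have "\<dots> = A * (1 + 2 * q / (1 - q)) * real (Suc K)"
    by (simp add: algebra_simps add_divide_distrib)
  finally show ?case .
qed simp

subsection \<open>Superposition of dyadic dilates\<close>

text \<open>Monotonicity in one variable at a time, with no exchange of integrals. The upper bound
  also provides integrability of the inner and outer integrands; without it a Bochner integral could
  be 0 by convention and the lower bound would be lost.\<close>

lemma iterated_integral_separable_bounds:
  fixes F :: "'a::euclidean_space \<Rightarrow> 'a \<Rightarrow> real"
  assumes F [measurable]: "case_prod F \<in> borel_measurable (lborel \<Otimes>\<^sub>M lborel)"
    and nonneg: "\<And>h s. 0 \<le> F h s"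
    and le: "\<And>h s. F h s \<le> (\<Sum>i\<in>A. c i * g i h * g i s)"
    and g: "\<And>i. i \<in> A \<Longrightarrow> integrable lborel (g i)"
    and ge: "\<And>h s. b * p h * p s \<le> F h s"
    and p: "integrable lborel p"
  shows "(LINT h|lborel. LINT s|lborel. F h s) \<le> (\<Sum>i\<in>A. c i * (LINT h|lborel. g i h)\<^sup>2)"
    and "b * (LINT h|lborel. p h)\<^sup>2 \<le> (LINT h|lborel. LINT s|lborel. F h s)"
proof -
  have int1: "integrable lborel (\<lambda>s. \<Sum>i\<in>A. c i * g i h * g i s)" for h
    using g by (intro Bochner_Integration.integrable_sum integrable_mult_right)
  have int: "integrable lborel (F h)" for h
  proof (rule Bochner_Integration.integrable_bound[OF int1[of h]])
    show "AE s in lborel. norm (F h s) \<le> norm (\<Sum>i\<in>A. c i * g i h * g i s)"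
      using le[of h] nonneg[of h] by (intro AE_I2) (smt (verit) real_norm_def)
  qed measurable
  define J where "J h = (LINT s|lborel. F h s)" for h
  have J_le: "J h \<le> (\<Sum>i\<in>A. c i * g i h * (LINT s|lborel. g i s))" for h
  proof -
    have "J h \<le> (LINT s|lborel. (\<Sum>i\<in>A. c i * g i h * g i s))"
      unfolding J_def by (rule integral_mono[OF int int1 le])
    also have "\<dots> = (\<Sum>i\<in>A. c i * g i h * (LINT s|lborel. g i s))"
      using g by (subst Bochner_Integration.integral_sum) auto
    finally show ?thesis .
  qed
  have J_nonneg: "0 \<le> J h" for h
    unfolding J_def by (intro integral_nonneg_AE AE_I2 nonneg)
  have int2: "integrable lborel (\<lambda>h. \<Sum>i\<in>A. c i * g i h * (LINT s|lborel. g i s))"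
    using g by (intro Bochner_Integration.integrable_sum integrable_mult_right integrable_mult_left)
  have J_int: "integrable lborel J"
  proof (rule Bochner_Integration.integrable_bound[OF int2])
    show "J \<in> borel_measurable lborel"
      unfolding J_def by measurable
    show "AE h in lborel. norm (J h) \<le> norm (\<Sum>i\<in>A. c i * g i h * (LINT s|lborel. g i s))"
      using J_le J_nonneg by (intro AE_I2) (smt (verit) real_norm_def)
  qed
  have "(LINT h|lborel. J h) \<le> (LINT h|lborel. (\<Sum>i\<in>A. c i * g i h * (LINT s|lborel. g i s)))"
    by (rule integral_mono[OF J_int int2 J_le])
  also have "\<dots> = (\<Sum>i\<in>A. c i * (LINT h|lborel. g i h)\<^sup>2)"
    using g by (subst Bochner_Integration.integral_sum) (auto simp: power2_eq_square mult.assoc)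
  finally show "(LINT h|lborel. LINT s|lborel. F h s) \<le> (\<Sum>i\<in>A. c i * (LINT h|lborel. g i h)\<^sup>2)"
    unfolding J_def .
  have J_ge: "b * p h * (LINT s|lborel. p s) \<le> J h" for h
  proof -
    have "b * p h * (LINT s|lborel. p s) = (LINT s|lborel. b * p h * p s)"
      by simp
    also have "\<dots> \<le> J h"
      unfolding J_def using p by (intro integral_mono int ge) auto
    finally show ?thesis .
  qed
  have "b * (LINT h|lborel. p h)\<^sup>2 = (LINT h|lborel. b * p h * (LINT s|lborel. p s))"
    by (simp add: power2_eq_square)
  also have "\<dots> \<le> (LINT h|lborel. J h)"
    using p by (intro integral_mono J_int J_ge) auto
  finally show "b * (LINT h|lborel. p h)\<^sup>2 \<le> (LINT h|lborel. LINT s|lborel. F h s)"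
    unfolding J_def .
qed

definition multiscale_bump :: "real \<Rightarrow> real \<Rightarrow> nat \<Rightarrow> 'a::euclidean_space \<Rightarrow> real" where
  "multiscale_bump \<beta> R K x = (\<Sum>k<K. (R * 2 ^ k) powr \<beta> * bump (x /\<^sub>R (R * 2 ^ k)))"

lemma smooth_multiscale_bump: "smooth (multiscale_bump \<beta> R K)"
  unfolding multiscale_bump_def
  by (intro smooth_sum smooth_mult smooth_const smooth_bump_scaled) auto

lemma multiscale_bump_nonneg: "0 \<le> multiscale_bump \<beta> R K x"
  unfolding multiscale_bump_def by (intro sum_nonneg mult_nonneg_nonneg bump_nonneg) auto

lemma bump_scaled_eq_0: "0 < r \<Longrightarrow> 2 * r \<le> norm x \<Longrightarrow> bump (x /\<^sub>R r) = 0"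
  by (intro bump_eq_0) (simp add: field_simps)

lemma bump_scaled_eq: "0 < r \<Longrightarrow> norm x \<le> r \<Longrightarrow> bump (x /\<^sub>R r) = exp (- 1)"
  by (intro bump_eq) (simp add: field_simps)

text \<open>The largest scale present is R 2^(K-1); the more generous radius avoids the predecessor
  and covers the empty sum.\<close>

lemma multiscale_bump_eq_0:
  assumes "0 < R" "2 * (R * 2 ^ K) \<le> norm x"
  shows "multiscale_bump \<beta> R K x = 0"
  unfolding multiscale_bump_def
proof (intro sum.neutral ballI)
  fix k assume "k \<in> {..<K}"
  then have "R * 2 ^ k \<le> R * 2 ^ K"
    using assms by simp
  then have "2 * (R * 2 ^ k) \<le> norm x"
    using assms by linarith
  then have "bump (x /\<^sub>R (R * 2 ^ k)) = 0"
    using assms by (intro bump_scaled_eq_0) auto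
  then show "(R * 2 ^ k) powr \<beta> * bump (x /\<^sub>R (R * 2 ^ k)) = 0"
    by simp
qed

lemma le_dyadic_scale:
  fixes R y :: real
  assumes "0 < R" "y \<le> R"
  shows "y \<le> R * 2 ^ k"
proof -
  have "R * 1 \<le> R * 2 ^ k"
    using assms by (intro mult_left_mono) auto
  then show ?thesis
    using assms by linarith
qed

lemma multiscale_bump_pos:
  assumes "0 < R" "norm x \<le> R" "0 < K"
  shows "0 < multiscale_bump \<beta> R K x"
  unfolding multiscale_bump_def
proof (intro sum_pos)
  fix k
  have "bump (x /\<^sub>R (R * 2 ^ k)) = exp (- 1)"
    using assms by (intro bump_scaled_eq le_dyadic_scale) auto
  then show "0 < (R * 2 ^ k) powr \<beta> * bump (x /\<^sub>R (R * 2 ^ k))"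
    using assms by simp
qed (use assms in auto)

text \<open>Mixed differences of a dilate are those of \<open>bump\<close> with rescaled increments,
  so the constant found at unit scale serves all \<open>R\<close> and \<open>K\<close>. This
  uniformity is what allows \<open>K\<close> to be chosen afterwards.\<close>

lemma multiscale_bump_mixed_difference_le:
  "\<exists>C\<ge>0. \<forall>R K x h s. \<bar>multiscale_bump \<beta> R K (x + h + s) - multiscale_bump \<beta> R K (x + h)
      - multiscale_bump \<beta> R K (x + s) + multiscale_bump \<beta> R K (x :: 'a::euclidean_space)\<bar>
    \<le> C * (\<Sum>k<K. (R * 2 ^ k) powr \<beta> * (mnorm (h /\<^sub>R (R * 2 ^ k)) * mnorm (s /\<^sub>R (R * 2 ^ k))))"
proof -
  have "smooth (bump :: 'a \<Rightarrow> real)"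
    using smooth_bump_scaled[of 1] by simp
  then obtain C where C: "C \<ge> 0"
    "\<And>x h s :: 'a. \<bar>bump (x + h + s) - bump (x + h) - bump (x + s) + bump x\<bar> \<le> C * mnorm h * mnorm s"
    using mixed_difference_le_mnorm[OF _ compact_supportI[of 2 bump]] bump_eq_0 by blast
  have "\<bar>multiscale_bump \<beta> R K (x + h + s) - multiscale_bump \<beta> R K (x + h)
      - multiscale_bump \<beta> R K (x + s) + multiscale_bump \<beta> R K x\<bar>
    \<le> C * (\<Sum>k<K. (R * 2 ^ k) powr \<beta> * (mnorm (h /\<^sub>R (R * 2 ^ k)) * mnorm (s /\<^sub>R (R * 2 ^ k))))"
    for R K and x h s :: 'a
  proof -
    define D where "D k = bump ((x + h + s) /\<^sub>R (R * 2 ^ k)) - bump ((x + h) /\<^sub>R (R * 2 ^ k))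
      - bump ((x + s) /\<^sub>R (R * 2 ^ k)) + bump (x /\<^sub>R (R * 2 ^ k))" for k :: nat
    have D: "\<bar>D k\<bar> \<le> C * mnorm (h /\<^sub>R (R * 2 ^ k)) * mnorm (s /\<^sub>R (R * 2 ^ k))" for k
      unfolding D_def scaleR_add_right by (rule C(2))
    have "multiscale_bump \<beta> R K (x + h + s) - multiscale_bump \<beta> R K (x + h)
        - multiscale_bump \<beta> R K (x + s) + multiscale_bump \<beta> R K x = (\<Sum>k<K. (R * 2 ^ k) powr \<beta> * D k)"
      by (simp add: multiscale_bump_def D_def ring_distribs sum.distrib sum_subtractf)
    also have "\<bar>\<dots>\<bar> \<le> (\<Sum>k<K. \<bar>(R * 2 ^ k) powr \<beta> * D k\<bar>)"
      by (rule sum_abs)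
    also have "\<dots> \<le> (\<Sum>k<K. (R * 2 ^ k) powr \<beta> * (C * mnorm (h /\<^sub>R (R * 2 ^ k)) * mnorm (s /\<^sub>R (R * 2 ^ k))))"
      unfolding abs_mult by (intro sum_mono mult_mono D) auto
    finally show ?thesis
      by (simp add: sum_distrib_left mult_ac)
  qed
  then show ?thesis
    using C(1) by blast
qed

lemma mnorm_minus: "mnorm (- h) = mnorm h"
  by (simp add: mnorm_def)

text \<open>At \<open>x\<close> every dilate attains its maximum, so no summand on the right is
  negative. Once \<open>norm h\<close> is at least three times the scale, both \<open>x + h\<close>
  and \<open>x - h\<close> leave the support of the dilate and exactly 2 exp(-1) remains.\<close>

lemma multiscale_bump_second_difference_ge:
  fixes x h :: "'a::euclidean_space"
  assumes R: "0 < R" and x: "norm x \<le> R"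
  shows "(\<Sum>k<K. (R * 2 ^ k) powr \<beta> * (2 * exp (- 1) * indicator {h. 3 * (R * 2 ^ k) \<le> norm h} h))
    \<le> 2 * multiscale_bump \<beta> R K x - multiscale_bump \<beta> R K (x + h) - multiscale_bump \<beta> R K (x - h)"
proof -
  have le: "2 * exp (- 1) * indicator {h. 3 * r \<le> norm h} h
      \<le> 2 * bump (x /\<^sub>R r) - bump ((x + h) /\<^sub>R r) - bump ((x - h) /\<^sub>R r)"
    if r: "0 < r" "norm x \<le> r" for r
  proof (cases "3 * r \<le> norm h")
    case True
    have "norm h - norm x \<le> norm (x + h)" "norm h - norm x \<le> norm (x - h)"
      using norm_triangle_ineq2[of h "- x"] norm_triangle_ineq2[of h x]
      by (simp_all add: add.commute norm_minus_commute)
    then have "2 * r \<le> norm (x + h)" "2 * r \<le> norm (x - h)"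
      using True r by linarith+
    then show ?thesis
      using True r by (simp add: bump_scaled_eq bump_scaled_eq_0)
  next
    case False
    then show ?thesis
      using r bump_le[of "(x + h) /\<^sub>R r"] bump_le[of "(x - h) /\<^sub>R r"] by (simp add: bump_scaled_eq)
  qed
  have "(\<Sum>k<K. (R * 2 ^ k) powr \<beta> * (2 * exp (- 1) * indicator {h. 3 * (R * 2 ^ k) \<le> norm h} h))
    \<le> (\<Sum>k<K. (R * 2 ^ k) powr \<beta> * (2 * bump (x /\<^sub>R (R * 2 ^ k))
        - bump ((x + h) /\<^sub>R (R * 2 ^ k)) - bump ((x - h) /\<^sub>R (R * 2 ^ k))))"
    using R by (intro sum_mono mult_left_mono le le_dyadic_scale[OF R x]) auto
  also have "\<dots> = 2 * multiscale_bump \<beta> R K x - multiscale_bump \<beta> R K (x + h) - multiscale_bump \<beta> R K (x - h)"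
    by (simp add: multiscale_bump_def right_diff_distrib sum_subtractf sum_distrib_left mult.left_commute)
  finally show ?thesis .
qed

text \<open>The argument -\<beta>/2 lies strictly between -1 and 0, away from the poles of
  \<open>Gamma\<close>, where its value would be 0.\<close>

lemma c_const_nonzero:
  assumes "0 < \<beta>" "\<beta> < 2"
  shows "c_const \<beta> d \<noteq> 0"
proof -
  have "- \<beta> / 2 \<notin> \<int>\<^sub>\<le>\<^sub>0"
  proof
    assume "- \<beta> / 2 \<in> \<int>\<^sub>\<le>\<^sub>0"
    then obtain n :: int where "- \<beta> / 2 = of_int n"
      by (auto simp: nonpos_Ints_def)
    then have "- 1 < real_of_int n" "real_of_int n < 0"
      using assms by linarith+
    then show False
      by simp
  qed
  then have "Gamma (- \<beta> / 2) \<noteq> 0"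
    by (simp add: Gamma_eq_zero_iff)
  moreover have "Gamma ((real d + \<beta>) / 2) > 0"
    using assms by (intro Gamma_real_pos) auto
  ultimately show ?thesis
    unfolding c_const_def by simp
qed

section \<open>Choice of the number of scales and the final estimate\<close>

theorem theorem3p7:
  fixes \<beta> R \<mu> :: real
  assumes "0 < \<beta>" and "\<beta> < 2" and "0 < R" and "0 < \<mu>"
  shows "\<exists>u :: real^'n \<Rightarrow> real. smooth u \<and> compact_support u \<and>
           (\<forall>x. norm x \<le> R \<longrightarrow>
              0 < Gamma2 \<beta> u x \<and> Gamma2 \<beta> u x < \<mu> * (fracL \<beta> u x)\<^sup>2)"
proof -
  note \<beta> = assms(1,2) and R = assms(3) and \<mu> = assms(4)
  \<comment> \<open>Any exponent strictly between \<open>\<beta> / 2\<close> (decay of the cross terms) and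
    \<open>min 1 \<beta>\<close> (integrability) works.\<close>
  define \<theta> where "\<theta> = (\<beta> / 2 + min 1 \<beta>) / 2"
  have \<theta>: "\<beta> - 1 < \<theta>" "\<theta> < \<beta>" "0 \<le> \<theta>" "\<theta> \<le> 1" "0 < 2 * \<theta> - \<beta>"
    using \<beta> unfolding \<theta>_def by (auto simp: min_def field_simps)
  \<comment> \<open>The decay of the cross terms per dyadic step between two scales.\<close>
  define q where "q = (1 / 2) powr (2 * \<theta> - \<beta>)"
  have q: "0 \<le> q" "q < 1"
    using \<theta>(5) powr_less_mono'[of "1 / 2" 0 "2 * \<theta> - \<beta>"] by (auto simp: q_def)
  define I where "I = (LINT h|lborel. mnorm h * norm h powr \<theta> * levy_kernel \<beta> (h :: real^'n))"
  define \<kappa> where "\<kappa> = (LINT h|lborel. levy_kernel \<beta> h * indicator {h :: real^'n. 3 \<le> norm h} h)"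
  have \<kappa>: "0 < \<kappa>"
    unfolding \<kappa>_def using \<beta> by (intro integral_kernel_outside_pos) auto
  obtain C where C: "C \<ge> 0" "\<And>R K (x::real^'n) h s.
      \<bar>multiscale_bump \<beta> R K (x + h + s) - multiscale_bump \<beta> R K (x + h)
        - multiscale_bump \<beta> R K (x + s) + multiscale_bump \<beta> R K x\<bar>
      \<le> C * (\<Sum>k<K. (R * 2 ^ k) powr \<beta> * (mnorm (h /\<^sub>R (R * 2 ^ k)) * mnorm (s /\<^sub>R (R * 2 ^ k))))"
    using multiscale_bump_mixed_difference_le[of \<beta>, where 'a = "real^'n"] by blast
  \<comment> \<open>Up to powers of \<open>c\<close>, \<open>Gamma2\<close> will be at most
    \<open>B * K\<close> and the absolute value of \<open>fracL\<close> at least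
    \<open>A * K\<close>; hence any \<open>K\<close> above \<open>B / (\<mu> * A\<^sup>2)\<close>
    suffices.\<close>
  define B where "B = C\<^sup>2 * I\<^sup>2 * (1 + 2 * q / (1 - q))"
  define A where "A = 2 * exp (- 1) * \<kappa>"
  have A: "0 < A"
    using \<kappa> by (simp add: A_def)
  obtain K0 :: nat where K0: "B / (\<mu> * A\<^sup>2) < real K0"
    using reals_Archimedean2 by blast
  define K where "K = Suc K0"
  have "B / (\<mu> * A\<^sup>2) < real K"
    using K0 by (simp add: K_def)
  then have K: "0 < K" "B < \<mu> * A\<^sup>2 * real K"
    using \<mu> A by (auto simp: K_def divide_less_eq mult.commute)
  define r where "r k = R * 2 ^ k" for k :: nat
  have r: "0 < r k" for k
    using R by (simp add: r_def)
  define u where "u = (multiscale_bump \<beta> R K :: real^'n \<Rightarrow> real)"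
  define c where "c = c_const \<beta> CARD('n)"
  have c: "0 < c\<^sup>2"
    using c_const_nonzero[OF \<beta>] by (simp add: c_def)
  have u: "smooth u" "compact_support u"
    unfolding u_def using R
    by (auto intro: smooth_multiscale_bump compact_supportI[OF multiscale_bump_eq_0])
  have [measurable]: "u \<in> borel_measurable borel"
    using smooth_imp_continuous_on[OF u(1)] by (rule borel_measurable_continuous_onI)
  define g where "g j k h = mnorm (h /\<^sub>R r j) * mnorm (h /\<^sub>R r k) * levy_kernel \<beta> h" for j k and h :: "real^'n"
  have g_int: "integrable lborel (g j k)" for j k
    unfolding g_def by (rule integrable_mnorm_mnorm_kernel[OF \<theta>(1-4) r r])
  have D: "\<bar>u (x + h + s) - u (x + h) - u (x + s) + u x\<bar>
      \<le> C * (\<Sum>k<K. r k powr \<beta> * (mnorm (h /\<^sub>R r k) * mnorm (s /\<^sub>R r k)))" for x h s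
    unfolding u_def r_def by (rule C(2))
  have "0 < Gamma2 \<beta> u x \<and> Gamma2 \<beta> u x < \<mu> * (fracL \<beta> u x)\<^sup>2" if x: "norm x \<le> R" for x
  proof -
    define F where "F h s = (u (x + h + s) - u (x + h) - u (x + s) + u x)\<^sup>2
      * (levy_kernel \<beta> h * levy_kernel \<beta> s)" for h s
    define G where "G = (LINT h|lborel. LINT s|lborel. F h s)"
    have Gamma2: "Gamma2 \<beta> u x = c\<^sup>2 * G"
      by (simp add: Gamma2_def c_def G_def F_def levy_kernel_def)
    have F_meas: "case_prod F \<in> borel_measurable (lborel \<Otimes>\<^sub>M lborel)"
      unfolding F_def by measurable
    have F_nonneg: "0 \<le> F h s" for h s
      by (simp add: F_def kernel_nonneg)
    \<comment> \<open>Squaring the sum over scales gives a sum over pairs of scales, each term of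
      which separates into the same function of \<open>h\<close> and of \<open>s\<close>.\<close>
    have F_le: "F h s \<le> (\<Sum>i\<in>{..<K} \<times> {..<K}.
        C\<^sup>2 * (r (fst i) powr \<beta> * r (snd i) powr \<beta>) * g (fst i) (snd i) h * g (fst i) (snd i) s)" for h s
    proof -
      let ?S = "\<Sum>k<K. r k powr \<beta> * (mnorm (h /\<^sub>R r k) * mnorm (s /\<^sub>R r k))"
      have "(u (x + h + s) - u (x + h) - u (x + s) + u x)\<^sup>2 \<le> (C * ?S)\<^sup>2"
        using D[of x h s] by (intro power2_le_iff_abs_le[THEN iffD2]) auto
      then have "F h s \<le> (C * ?S)\<^sup>2 * (levy_kernel \<beta> h * levy_kernel \<beta> s)"
        unfolding F_def by (intro mult_right_mono) (auto simp: kernel_nonneg)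
      also have "\<dots> = C\<^sup>2 * (?S * ?S) * (levy_kernel \<beta> h * levy_kernel \<beta> s)"
        by (simp add: power2_eq_square)
      also have "\<dots> = (\<Sum>i\<in>{..<K} \<times> {..<K}.
        C\<^sup>2 * (r (fst i) powr \<beta> * r (snd i) powr \<beta>) * g (fst i) (snd i) h * g (fst i) (snd i) s)"
        unfolding sum_product sum.cartesian_product sum_distrib_left sum_distrib_right
        by (intro sum.cong) (auto simp: g_def)
      finally show ?thesis .
    qed
    \<comment> \<open>Strict positivity is tested on increments so large that \<open>x + h\<close>
      and \<open>x + s\<close> both lie outside the support of \<open>u\<close>.\<close>
    define p where "p h = levy_kernel \<beta> h * indicator {h. 3 * (R * 2 ^ K) \<le> norm h} h" for h :: "real^'n"
    have p_int: "integrable lborel p"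
      unfolding p_def using \<beta> R by (intro integrable_kernel_outside_scaled) auto
    have "(R * 2 ^ K) powr \<beta> * (LINT h|lborel. p h) = \<kappa>"
      unfolding p_def \<kappa>_def using \<beta> R by (intro integral_kernel_outside_scaled) auto
    then have p_pos: "(LINT h|lborel. p h) \<noteq> 0"
      using \<kappa> by auto
    have ux: "0 < u x"
      unfolding u_def using R x K by (intro multiscale_bump_pos)
    have F_ge: "(u x)\<^sup>2 * p h * p s \<le> F h s" for h s
    proof (cases "3 * (R * 2 ^ K) \<le> norm h \<and> 3 * (R * 2 ^ K) \<le> norm s")
      case True
      have "u (x + h) = 0" if "3 * (R * 2 ^ K) \<le> norm h" for h
      proof -
        have "norm h - norm x \<le> norm (x + h)"
          using norm_triangle_ineq2[of h "- x"] by (simp add: add.commute)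
        then have "2 * (R * 2 ^ K) \<le> norm (x + h)"
          using that le_dyadic_scale[OF R x, of K] by linarith
        then show ?thesis
          unfolding u_def using R by (intro multiscale_bump_eq_0)
      qed
      then have "u (x + h) = 0" "u (x + s) = 0"
        using True by auto
      \<comment> \<open>The point \<open>x + h + s\<close> may return to the support, but
        \<open>u\<close> is nonnegative, so it cannot cancel \<open>u x\<close>.\<close>
      moreover have "(u x)\<^sup>2 \<le> (u (x + h + s) + u x)\<^sup>2"
        using ux by (intro power_mono) (auto simp: u_def multiscale_bump_nonneg)
      ultimately show ?thesis
        unfolding F_def p_def using True
        by (auto intro!: mult_right_mono mult_nonneg_nonneg simp: kernel_nonneg mult.assoc)
    next
      case False
      then show ?thesis
        using F_nonneg[of h s] by (auto simp: p_def)
    qed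
    note bounds = iterated_integral_separable_bounds[OF F_meas F_nonneg F_le g_int F_ge p_int]
    have "0 < (u x)\<^sup>2 * (LINT h|lborel. p h)\<^sup>2"
      using ux p_pos by simp
    also have "\<dots> \<le> G"
      unfolding G_def by (rule bounds(2))
    finally have G_pos: "0 < G" .
    define a where "a j k = C\<^sup>2 * (r j powr \<beta> * r k powr \<beta>) * (LINT h|lborel. g j k h)\<^sup>2" for j k
    have a: "a j k \<le> (C\<^sup>2 * I\<^sup>2) * q ^ (k - j)" if "j \<le> k" for j k
    proof -
      have "r j powr \<beta> * r k powr \<beta> * (LINT h|lborel. g j k h)\<^sup>2 \<le> I\<^sup>2 * (r j / r k) powr (2 * \<theta> - \<beta>)"
        unfolding g_def I_def by (rule integral_mnorm_mnorm_kernel[OF \<theta>(1-4) r r])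
      also have "r j / r k = (1 / 2) ^ (k - j)"
        using that R by (simp add: r_def power_diff power_divide)
      also have "((1 / 2 :: real) ^ (k - j)) powr (2 * \<theta> - \<beta>) = q ^ (k - j)"
        unfolding q_def by (simp add: powr_realpow[symmetric] powr_powr mult.commute)
      finally show ?thesis
        unfolding a_def by (simp add: mult.assoc mult_left_mono)
    qed
    have a_sym: "a j k = a k j" for j k
      unfolding a_def g_def by (simp add: mult_ac)
    have "G \<le> (\<Sum>j<K. \<Sum>k<K. a j k)"
      using bounds(1) by (simp add: G_def a_def sum.cartesian_product case_prod_unfold)
    also have "\<dots> \<le> C\<^sup>2 * I\<^sup>2 * (1 + 2 * q / (1 - q)) * real K"
      by (rule double_geometric_sum_le[OF q a a_sym]) auto
    finally have G_le: "G \<le> B * real K"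
      by (simp add: B_def)
    \<comment> \<open>The sign is reversed to make the integrand nonnegative; only the square of
      \<open>fracL\<close> matters.\<close>
    define L where "L h = (2 * u x - u (x + h) - u (x - h)) * levy_kernel \<beta> h" for h
    define Q where "Q = (LINT h|lborel. L h)"
    have "(u (x + h) - 2 * u x + u (x - h)) / norm h powr (real CARD('n) + \<beta>) = - L h" for h
      by (simp add: L_def levy_kernel_def diff_divide_distrib add_divide_distrib)
    then have fracL: "fracL \<beta> u x = - (c * Q)"
      by (simp add: fracL_def c_def Q_def)
    have L_int: "integrable lborel L"
    proof (rule Bochner_Integration.integrable_bound)
      show "integrable lborel (\<lambda>h. C * (\<Sum>k<K. r k powr \<beta> * g k k h))"
        by (intro integrable_mult_right Bochner_Integration.integrable_sum g_int)
      show "AE h in lborel. norm (L h) \<le> norm (C * (\<Sum>k<K. r k powr \<beta> * g k k h))"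
      proof (intro AE_I2)
        fix h
        \<comment> \<open>The symmetric second difference is, up to sign, the mixed difference with
          increments \<open>h\<close> and \<open>- h\<close>, so integrability of \<open>L\<close>
          follows from the diagonal functions \<open>g k k\<close>.\<close>
        have "\<bar>2 * u x - u (x + h) - u (x - h)\<bar> \<le> C * (\<Sum>k<K. r k powr \<beta> * (mnorm (h /\<^sub>R r k) * mnorm (h /\<^sub>R r k)))"
          using D[of x h "- h"] by (simp add: mnorm_minus)
        then have "\<bar>L h\<bar> \<le> C * (\<Sum>k<K. r k powr \<beta> * (mnorm (h /\<^sub>R r k) * mnorm (h /\<^sub>R r k))) * levy_kernel \<beta> h"
          unfolding L_def abs_mult by (intro mult_mono) (auto simp: kernel_nonneg)
        also have "\<dots> = C * (\<Sum>k<K. r k powr \<beta> * g k k h)"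
          by (simp add: g_def sum_distrib_left sum_distrib_right mult_ac)
        finally show "norm (L h) \<le> norm (C * (\<Sum>k<K. r k powr \<beta> * g k k h))"
          by simp
      qed
      show "L \<in> borel_measurable lborel"
        unfolding L_def by measurable
    qed
    define T where "T k h = levy_kernel \<beta> h * indicator {h. 3 * r k \<le> norm h} h" for k and h :: "real^'n"
    have T_int: "integrable lborel (T k)" for k
      unfolding T_def using \<beta> r by (intro integrable_kernel_outside_scaled) auto
    have T: "r k powr \<beta> * (LINT h|lborel. T k h) = \<kappa>" for k
      unfolding T_def \<kappa>_def using \<beta> r by (intro integral_kernel_outside_scaled) auto
    \<comment> \<open>Every scale contributes the same amount \<open>A\<close>, since its weight
      cancels the scaling of the kernel mass.\<close>
    have "A * real K = (\<Sum>k<K. 2 * exp (- 1) * (r k powr \<beta> * (LINT h|lborel. T k h)))"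
      unfolding T by (simp add: A_def)
    also have "\<dots> = (LINT h|lborel. (\<Sum>k<K. 2 * exp (- 1) * (r k powr \<beta> * T k h)))"
      using T_int by (subst Bochner_Integration.integral_sum) auto
    also have "\<dots> \<le> Q"
      unfolding Q_def
    proof (intro integral_mono L_int Bochner_Integration.integrable_sum integrable_mult_right T_int)
      fix h
      have "(\<Sum>k<K. 2 * exp (- 1) * (r k powr \<beta> * T k h))
        = (\<Sum>k<K. r k powr \<beta> * (2 * exp (- 1) * indicator {h. 3 * r k \<le> norm h} h)) * levy_kernel \<beta> h"
        unfolding T_def sum_distrib_right by (intro sum.cong) (auto simp: mult_ac)
      also have "\<dots> \<le> L h"
        unfolding L_def u_def r_def
        by (intro mult_right_mono multiscale_bump_second_difference_ge R x kernel_nonneg)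
      finally show "(\<Sum>k<K. 2 * exp (- 1) * (r k powr \<beta> * T k h)) \<le> L h" .
    qed
    finally have "(A * real K)\<^sup>2 \<le> Q\<^sup>2"
      using A by (intro power_mono) auto
    moreover have "B * real K < \<mu> * (A * real K)\<^sup>2"
      using K mult_strict_right_mono[of B "\<mu> * A\<^sup>2 * real K" "real K"] by (simp add: power2_eq_square mult_ac)
    ultimately have "G < \<mu> * Q\<^sup>2"
      using G_le \<mu> by (smt (verit) mult_left_mono)
    then have "c\<^sup>2 * G < c\<^sup>2 * (\<mu> * Q\<^sup>2)"
      using c by simp
    then show ?thesis
      using c G_pos by (simp add: Gamma2 fracL power_mult_distrib mult_ac)
  qed
  then show ?thesis
    using u by blast
qed

end
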